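(* (a) Let $A,A^*:\Omega\to\mathbb{R}$ be Lipschitz functions ($A$ regarded as a function depending only on the future coordinates $x$, $A^*$ as a function depending only on the past coordinates $y$) and assume that there exists $W:\Omega\times\Omega\to\mathbb{R}$ such that for all $i\in\{1,\dots,r\}$ and all $x,y\in\Omega$ $$A(ix)+W(ix,y)=A^*(\tau_i(y))+W(x,\tau_i(y)).$$ If $\rho_{A^*}$ is the eigenprobability for the $\Phi$-Ruelle operator $\mathcal{L}_{A^*,\Phi}$ of the potential $A^*$, then the function $$h(x)=\int e^{W(x,y)}\,d\rho_{A^*}(y)$$ is the eigenfunction for the $\sigma$-Ruelle operator $\mathcal{L}_{A,\sigma}$ of the potential $A$. (b) Moreover, given a Lipschitz function $A^*:\Omega\to\mathbb{R}$ (of the variable $y$), there exist a Lipschitz function $A:\Omega\to\mathbb{R}$ (of the variable $x$) and a function $W:\Omega\times\Omega\to\mathbb{R}$ as in (a), i.e. satisfying the displayed identity for all $i,x,y$.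
   Context: $\mathcal{A}=\{1,\dots,r\}$, $\Omega=\mathcal{A}^{\mathbb{N}}$ with metric $d(x,y)=2^{-\min\{j\ge1:\,x_j\neq y_j\}}$ for $x\ne y$, $d(x,x)=0$. $\sigma$ is the left shift on $\Omega$, and $ix=(i,x_1,x_2,\dots)$. Points of $\Omega\times\Omega$ are written $(x,y)$, with $x$ called the future and $y$ the past. Let $\phi:\mathcal{A}\times\mathcal{A}\to\mathcal{A}$ be a local rule such that $b\mapsto\phi(a,b)$ is bijective for every fixed $a$, and let $\Phi:\Omega\to\Omega$, $\Phi(x_1,x_2,x_3,\dots)=(\phi(x_1,x_2),\phi(x_2,x_3),\dots)$, be the associated permutative cellular automaton. For $j\in\mathcal{A}$, $\tau_j:\Omega\to\Omega$ is the inverse branch: $\tau_j(x)$ is the unique $y$ with $\Phi(y)=x$ and $y_1=j$. For $\Pi\in\{\sigma,\Phi\}$ and Lipschitz $B:\Omega\to\mathbb{R}$, $\mathcal{L}_{B,\Pi}(f)(y)=\sum_{\Pi(x)=y}e^{B(x)}f(x)$ on $C(\Omega,\mathbb{R})$. By Ruelle's theorem there is a main eigenvalue $\lambda_{B,\Pi}>0$, which is simple and has a strictly positive Lipschitz eigenfunction, unique up to a positive scalar ("the eigenfunction"), and there is a probability $\rho_B$ with $\mathcal{L}_{B,\Pi}^*\rho_B=\lambda_{B,\Pi}\,\rho_B$ ("the eigenprobability").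
   Formalization: W is required to be continuous on Ω×Ω (assumed in (a), proved in (b)); without regularity (a) fails, e.g. adding to W the indicator of "x is eventually constant" keeps the identity but makes h discontinuous when r ≥ 2. *)

theory Defs
  imports "HOL-Analysis.Analysis" "HOL-Library.Stream"
begin

text \<open>
  The alphabet is an arbitrary finite type and the sequence space is the type of streams over it.
  Streams are indexed from 0, so \<open>x !! n\<close> is the coordinate with number \<open>n + 1\<close>; the shift is \<open>stl\<close>
  and prepending a letter is \<open>i ## x\<close>.
\<close>

instantiation stream :: (type) metric_space
begin

text \<open>The \<open>Suc\<close> accounts for coordinates being numbered from 1 in the exponent of the metric.\<close>

definition dist_stream :: "'a stream \<Rightarrow> 'a stream \<Rightarrow> real" where
  "dist_stream x y = (if x = y then 0 else (1 / 2) ^ Suc (LEAST n. x !! n \<noteq> y !! n))"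

definition uniformity_stream :: "('a stream \<times> 'a stream) filter" where
  "uniformity_stream = (INF e\<in>{0<..}. principal {(x, y). dist x y < e})"

definition open_stream :: "'a stream set \<Rightarrow> bool" where
  "open_stream U \<longleftrightarrow> (\<forall>x\<in>U. eventually (\<lambda>(x', y). x' = x \<longrightarrow> y \<in> U) uniformity)"

instance
proof
  show "uniformity = (INF e\<in>{0<..}. principal {(x::'a stream, y). dist x y < e})"
    by (rule uniformity_stream_def)
  show "open U \<longleftrightarrow> (\<forall>x\<in>U. eventually (\<lambda>(x', y). x' = x \<longrightarrow> y \<in> U) uniformity)"
    for U :: "'a stream set"
    by (rule open_stream_def)
  show "dist x y = 0 \<longleftrightarrow> x = y" for x y :: "'a stream"
    by (simp add: dist_stream_def)
  have comm: "dist u v = dist v u" for u v :: "'a stream"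
  proof -
    have "(\<lambda>n. u !! n \<noteq> v !! n) = (\<lambda>n. v !! n \<noteq> u !! n)"
      by (intro ext) (rule neq_commute)
    then show ?thesis
      unfolding dist_stream_def by simp
  qed
  have self_zero: "dist u u = 0" and dist_nonneg: "0 \<le> dist u v" for u v :: "'a stream"
    by (simp_all add: dist_stream_def)
  show "dist x y \<le> dist x z + dist y z" for x y z :: "'a stream"
  proof (cases "x = y \<or> x = z \<or> y = z")
    case True
    then show ?thesis
      using dist_nonneg[of x z] dist_nonneg[of y z] self_zero[of x] comm[of x y] by auto
  next
    case False
    define m where "m = (LEAST n. x !! n \<noteq> y !! n)"
    have "\<exists>n. x !! n \<noteq> y !! n"
      using False by (metis stream_smap_nats smap_alt)
    then have "x !! m \<noteq> y !! m"
      unfolding m_def by (rule LeastI_ex)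
    then consider "x !! m \<noteq> z !! m" | "y !! m \<noteq> z !! m"
      by metis
    then have "(LEAST n. x !! n \<noteq> z !! n) \<le> m \<or> (LEAST n. y !! n \<noteq> z !! n) \<le> m"
      by cases (auto intro: Least_le)
    moreover have "(1 / 2) ^ Suc m \<le> (1 / 2 :: real) ^ Suc k" if "k \<le> m" for k
      using that by (intro power_decreasing) simp_all
    ultimately have "dist x y \<le> dist x z \<or> dist x y \<le> dist y z"
      unfolding dist_stream_def m_def[symmetric] using False by presburger
    then show ?thesis
      using dist_nonneg[of x z] dist_nonneg[of y z] by linarith
  qed
qed

end

definition lipschitz :: "('a::metric_space \<Rightarrow> real) \<Rightarrow> bool" where
  "lipschitz f \<longleftrightarrow> (\<exists>C. C-lipschitz_on UNIV f)"

definition cellular_automaton :: "('a \<Rightarrow> 'a \<Rightarrow> 'a) \<Rightarrow> 'a stream \<Rightarrow> 'a stream" where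
  "cellular_automaton \<phi> x = smap2 \<phi> x (stl x)"

definition inverse_branch :: "('a \<Rightarrow> 'a \<Rightarrow> 'a) \<Rightarrow> 'a \<Rightarrow> 'a stream \<Rightarrow> 'a stream" where
  "inverse_branch \<phi> j x = (THE y. cellular_automaton \<phi> y = x \<and> shd y = j)"

definition ruelle_operator ::
  "('b \<Rightarrow> 'b) \<Rightarrow> ('b \<Rightarrow> real) \<Rightarrow> ('b \<Rightarrow> real) \<Rightarrow> 'b \<Rightarrow> real" where
  "ruelle_operator T B f y = (\<Sum>x\<in>{x. T x = y}. exp (B x) * f x)"

definition positive_eigenfunction ::
  "('b::metric_space \<Rightarrow> 'b) \<Rightarrow> ('b \<Rightarrow> real) \<Rightarrow> real \<Rightarrow> ('b \<Rightarrow> real) \<Rightarrow> bool" where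
  "positive_eigenfunction T B l h \<longleftrightarrow>
     lipschitz h \<and> (\<forall>x. 0 < h x) \<and> (\<forall>y. ruelle_operator T B h y = l * h y)"

text \<open>
  The main eigenvalue of the operator on continuous real functions: positive, with a strictly positive
  Lipschitz eigenfunction, simple (the generalized eigenspace is one-dimensional), and
  maximal in modulus among the real eigenvalues.
\<close>

definition main_eigenvalue ::
  "('b::metric_space \<Rightarrow> 'b) \<Rightarrow> ('b \<Rightarrow> real) \<Rightarrow> real \<Rightarrow> bool" where
  "main_eigenvalue T B l \<longleftrightarrow>
     0 < l \<and>
     (\<exists>h. positive_eigenfunction T B l h \<and>
        (\<forall>f n. continuous_on UNIV f \<and>
               ((\<lambda>g y. ruelle_operator T B g y - l * g y) ^^ n) f = (\<lambda>_. 0) \<longrightarrow>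
               (\<exists>c. \<forall>x. f x = c * h x))) \<and>
     (\<forall>m f. continuous_on UNIV f \<and> (\<exists>x. f x \<noteq> 0) \<and> (\<forall>y. ruelle_operator T B f y = m * f y) \<longrightarrow>
            \<bar>m\<bar> \<le> l)"

text \<open>``The eigenfunction'' is determined only up to a positive scalar, hence a predicate.\<close>

definition main_eigenfunction ::
  "('b::metric_space \<Rightarrow> 'b) \<Rightarrow> ('b \<Rightarrow> real) \<Rightarrow> ('b \<Rightarrow> real) \<Rightarrow> bool" where
  "main_eigenfunction T B h \<longleftrightarrow> (\<exists>l. main_eigenvalue T B l \<and> positive_eigenfunction T B l h)"

definition eigenprobability ::
  "('b::metric_space \<Rightarrow> 'b) \<Rightarrow> ('b \<Rightarrow> real) \<Rightarrow> 'b measure \<Rightarrow> bool" where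
  "eigenprobability T B \<rho> \<longleftrightarrow>
     sets \<rho> = sets borel \<and> emeasure \<rho> (space \<rho>) = 1 \<and>
     (\<exists>l. main_eigenvalue T B l \<and>
        (\<forall>f. continuous_on UNIV f \<longrightarrow>
             (\<integral>y. ruelle_operator T B f y \<partial>\<rho>) = l * (\<integral>y. f y \<partial>\<rho>)))"

text \<open>
  Continuity of \<open>W\<close> is part of the notion. Without it the integral in the theorem may be undefined, and
  even a bounded Borel \<open>W\<close> can be changed by a discontinuous function invariant under
  \<open>(i ## x, y) \<mapsto> (x, inverse_branch \<phi> i y)\<close>, such as the indicator of ``\<open>x\<close> is eventually
  constant'', without affecting the identity.
\<close>

definition involution_kernel ::
  "('a \<Rightarrow> 'a \<Rightarrow> 'a) \<Rightarrow> ('a stream \<Rightarrow> real) \<Rightarrow> ('a stream \<Rightarrow> real) \<Rightarrow>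
   ('a stream \<times> 'a stream \<Rightarrow> real) \<Rightarrow> bool" where
  "involution_kernel \<phi> A A' W \<longleftrightarrow>
     continuous_on UNIV W \<and>
     (\<forall>i x y. A (i ## x) + W (i ## x, y) = A' (inverse_branch \<phi> i y) + W (x, inverse_branch \<phi> i y))"

end

theory Submission
  imports Defs
begin

text \<open>
  By the kernel identity, applying the shift operator of \<open>A\<close> to \<open>exp W\<close> in the first variable gives the
  same function as applying the automaton operator of \<open>A'\<close> in the second. Integrating against the
  eigenprobability turns the latter into multiplication by the eigenvalue, so \<open>h\<close> is a positive
  eigenfunction; that its eigenvalue is the main one follows from a maximum principle.
\<close>

section \<open>The space of streams\<close>

lemma stream_eq_iff_snth: "x = y \<longleftrightarrow> (\<forall>n. x !! n = y !! n)"
  by (metis stream_smap_nats smap_alt)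

lemma stake_eq_iff_snth: "stake n x = stake n y \<longleftrightarrow> (\<forall>k<n. x !! k = y !! k)"
  by (auto simp: list_eq_iff_nth_eq stake_nth)

lemma dist_streamE:
  fixes x y :: "'a stream"
  assumes "x \<noteq> y"
  obtains n where "stake n x = stake n y" "dist x y = (1 / 2) ^ Suc n"
proof
  let ?n = "LEAST n. x !! n \<noteq> y !! n"
  show "stake ?n x = stake ?n y"
    using not_less_Least by (fastforce simp: stake_eq_iff_snth)
  show "dist x y = (1 / 2) ^ Suc ?n"
    using assms by (simp add: dist_stream_def)
qed

lemma dist_stream_le:
  fixes x y :: "'a stream"
  assumes "stake n x = stake n y"
  shows "dist x y \<le> (1 / 2) ^ Suc n"
proof (cases "x = y")
  case False
  then have "\<exists>n. x !! n \<noteq> y !! n"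
    by (simp add: stream_eq_iff_snth)
  then have "x !! (LEAST n. x !! n \<noteq> y !! n) \<noteq> y !! (LEAST n. x !! n \<noteq> y !! n)"
    by (rule LeastI_ex)
  then have "n \<le> (LEAST n. x !! n \<noteq> y !! n)"
    using assms by (meson not_le stake_eq_iff_snth)
  then show ?thesis
    using False by (simp add: dist_stream_def power_decreasing)
qed simp

lemma dist_stream_le_1: "dist x y \<le> 1" for x y :: "'a stream"
  using dist_stream_le[of 0 x y] by simp

text \<open>One more common letter halves the distance. This is the common source of the contraction
  by prepending a letter and by inverse branches.\<close>

lemma dist_stream_half:
  fixes u v :: "'a stream" and x y :: "'b stream"
  assumes "\<And>n. stake n x = stake n y \<Longrightarrow> stake (Suc n) u = stake (Suc n) v"
  shows "dist u v \<le> dist x y / 2"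
proof (cases "x = y")
  case True
  then have "stake (Suc n) u = stake (Suc n) v" for n
    using assms[of n] by simp
  then have "u = v"
    by (metis lessI stake_eq_iff_snth stream_eq_iff_snth)
  with True show ?thesis by simp
next
  case False
  then obtain n where n: "stake n x = stake n y" "dist x y = (1 / 2) ^ Suc n"
    by (rule dist_streamE)
  from dist_stream_le[OF assms[OF n(1)]] n(2) show ?thesis by simp
qed

lemma dist_SCons_le: "dist (i ## x) (i ## y) \<le> dist x y / 2"
  by (rule dist_stream_half) simp

section \<open>Contractions and Lipschitz functions\<close>

lemma continuous_on_contraction:
  fixes f :: "'a::metric_space \<Rightarrow> 'b::metric_space"
  assumes "\<And>x y. dist (f x) (f y) \<le> dist x y / 2"
  shows "continuous_on S f"
  by (rule lipschitz_on_continuous_on[where L = "1/2"])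
     (use assms in \<open>auto intro!: lipschitz_onI\<close>)

lemma continuous_on_SCons: "continuous_on S ((##) i)"
  by (rule continuous_on_contraction) (rule dist_SCons_le)

text \<open>The factor 2 compensates for the exponent \<open>Suc n\<close> in the metric: when the
  common prefix has length exactly \<open>n\<close>, \<open>(1 / 2) ^ n\<close> is twice the
  distance.\<close>

lemma dist_boundI_stake:
  fixes f :: "'a stream \<Rightarrow> real"
  assumes "\<And>n x y. stake n x = stake n y \<Longrightarrow> \<bar>f x - f y\<bar> \<le> K * (1 / 2) ^ n"
  shows "\<bar>f x - f y\<bar> \<le> 2 * K * dist x y"
proof (cases "x = y")
  case False
  then obtain n where "stake n x = stake n y" and d: "dist x y = (1 / 2) ^ Suc n"
    by (rule dist_streamE)
  with assms[of n x y] show ?thesis unfolding d by simp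
qed simp

lemma lipschitzI:
  assumes "\<And>x y. \<bar>f x - f y\<bar> \<le> C * dist x y" "0 \<le> C"
  shows "lipschitz f"
  unfolding lipschitz_def using assms
  by (intro exI[of _ C] lipschitz_onI) (auto simp: dist_real_def)

lemma lipschitzE:
  assumes "lipschitz f"
  obtains C where "0 \<le> C" "\<And>x y. \<bar>f x - f y\<bar> \<le> C * dist x y"
  using assms unfolding lipschitz_def lipschitz_on_def dist_real_def by auto

lemma lipschitz_continuous_on: "lipschitz f \<Longrightarrow> continuous_on S f"
  unfolding lipschitz_def
  by (meson continuous_on_subset lipschitz_on_continuous_on subset_UNIV)

text \<open>By Tychonoff the countable power of the finite discrete alphabet is compact, and sending
  \<open>f\<close> to \<open>smap f nats\<close> maps it continuously onto the streams.\<close>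

lemma compact_UNIV_stream: "compact (UNIV :: 'a::finite stream set)"
proof -
  let ?X = "product_topology (\<lambda>_::nat. discrete_topology (UNIV :: 'a set)) UNIV"
  let ?F = "\<lambda>f :: nat \<Rightarrow> 'a. smap f nats"
  have "continuous_map ?X euclidean ?F"
    unfolding continuous_map_def
  proof (intro conjI allI impI)
    fix U :: "'a stream set"
    assume "openin euclidean U"
    then have U: "open U" by simp
    show "openin ?X {f \<in> topspace ?X. ?F f \<in> U}"
    proof (subst openin_subopen, intro ballI)
      fix f
      assume "f \<in> {f \<in> topspace ?X. ?F f \<in> U}"
      then have "?F f \<in> U" by simp
      then obtain e where e: "e > 0" "ball (?F f) e \<subseteq> U"
        using openE[OF U] by blast
      obtain n where n: "(1 / 2 :: real) ^ n < e"
        using e(1) real_arch_pow_inv[of e "1/2"] by auto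
      \<comment> \<open>A cylinder: fixing finitely many coordinates gives an open neighbourhood of
        \<open>f\<close> whose image lies in the ball around \<open>?F f\<close>.\<close>
      let ?T = "{g. \<forall>k<n. g k = f k}"
      have "?T = PiE UNIV (\<lambda>k. if k < n then {f k} else UNIV)"
        by (auto simp: PiE_def Pi_def split: if_splits)
      moreover have "openin ?X (PiE UNIV (\<lambda>k. if k < n then {f k} else UNIV))"
        by (auto simp: openin_PiE_gen intro: finite_subset[of _ "{..<n}"])
      ultimately have "openin ?X ?T" by simp
      moreover have "?F g \<in> U" if "g \<in> ?T" for g
      proof -
        have "stake n (?F f) = stake n (?F g)"
          using that by (simp add: stake_eq_iff_snth)
        then have "dist (?F f) (?F g) \<le> (1 / 2) ^ Suc n"
          by (rule dist_stream_le)
        also have "\<dots> \<le> (1 / 2) ^ n" by simp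
        finally show ?thesis
          using n e(2) by (auto simp: subset_iff)
      qed
      ultimately show "\<exists>T. openin ?X T \<and> f \<in> T \<and> T \<subseteq> {f \<in> topspace ?X. ?F f \<in> U}"
        by (intro exI[of _ ?T]) auto
    qed
  qed auto
  moreover have "compact_space ?X"
    by (simp add: compact_space_product_topology compact_space_discrete_topology)
  then have "compactin ?X UNIV"
    by (simp add: compact_space_def)
  ultimately have "compactin euclidean (?F ` UNIV)"
    by (rule image_compactin[rotated])
  moreover have "?F ` UNIV = (UNIV :: 'a stream set)"
    using stream_smap_nats by (metis surj_def)
  ultimately show ?thesis by simp
qed

section \<open>Ruelle operators of the shift\<close>

lemma ruelle_operator_shift:
  "ruelle_operator stl B f y = (\<Sum>i\<in>UNIV. exp (B (i ## y)) * f (i ## y))"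
proof -
  have "{x. stl x = y} = range (\<lambda>i. i ## y)"
    by (auto simp: image_iff) (metis stream.collapse)
  moreover have "inj (\<lambda>i. i ## y)"
    by (auto intro: injI)
  ultimately show ?thesis
    by (simp add: ruelle_operator_def sum.reindex)
qed

lemma continuous_on_ruelle_operator_shift:
  fixes B :: "'a::finite stream \<Rightarrow> real"
  assumes "continuous_on UNIV B" "continuous_on UNIV f"
  shows "continuous_on UNIV (ruelle_operator stl B f)"
proof -
  have "continuous_on UNIV (\<lambda>y. g (i ## y))" if "continuous_on UNIV g"
    for g :: "'a stream \<Rightarrow> real" and i
    by (rule continuous_on_compose2[OF that continuous_on_SCons]) simp
  with assms show ?thesis
    unfolding ruelle_operator_shift[abs_def] by (intro continuous_intros) auto
qed

text \<open>
  Uniqueness, simplicity and maximality follow from the maximum principle for \<open>f / h\<close>: dividing by the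
  positive eigenfunction turns the operator into a Markov operator, and the backward orbit of a single
  point is dense.
\<close>

context
  fixes B h :: "'a::finite stream \<Rightarrow> real" and l :: real
  assumes cont_B: "continuous_on UNIV B"
    and cont_h: "continuous_on UNIV h"
    and h_pos: "\<And>x. 0 < h x"
    and h_eigen: "\<And>y. ruelle_operator stl B h y = l * h y"
begin

text \<open>Since \<open>l\<close> is the quotient of the operator applied to \<open>h\<close> by
  \<open>h\<close> itself, subtracting \<open>l * f\<close> leaves a positively weighted sum of
  increments of \<open>f / h\<close>. At a maximum of \<open>f / h\<close> every increment is
  nonpositive.\<close>

lemma ruelle_operator_diff:
  "ruelle_operator stl B f y - l * f y =
     (\<Sum>i\<in>UNIV. exp (B (i ## y)) * h (i ## y) * (f (i ## y) / h (i ## y) - f y / h y))"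
proof -
  have "l * f y = ruelle_operator stl B h y * (f y / h y)"
    using h_pos[of y] h_eigen[of y] by simp
  also have "\<dots> = (\<Sum>i\<in>UNIV. exp (B (i ## y)) * h (i ## y) * (f y / h y))"
    by (simp only: ruelle_operator_shift sum_distrib_right)
  finally have "l * f y = \<dots>" .
  moreover have "ruelle_operator stl B f y =
      (\<Sum>i\<in>UNIV. exp (B (i ## y)) * h (i ## y) * (f (i ## y) / h (i ## y)))"
    using h_pos by (simp add: ruelle_operator_shift less_imp_neq[THEN not_sym])
  ultimately show ?thesis
    by (simp add: sum_subtractf right_diff_distrib)
qed

lemma quotient_attains_max:
  assumes "continuous_on UNIV f"
  obtains x where "\<And>y. f y / h y \<le> f x / h x"
proof -
  have "continuous_on UNIV (\<lambda>x. f x / h x)"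
    using assms cont_h h_pos by (intro continuous_intros) (auto simp: less_imp_neq[THEN not_sym])
  then show ?thesis
    using continuous_attains_sup[OF compact_UNIV_stream] that by auto
qed

lemma ruelle_operator_le_at_max:
  assumes "\<And>y. f y / h y \<le> f x / h x"
  shows "ruelle_operator stl B f x - l * f x \<le> 0"
  unfolding ruelle_operator_diff using assms h_pos
  by (intro sum_nonpos mult_nonneg_nonpos) (auto simp: less_imp_le)

text \<open>Evaluating at a maximum of \<open>f / h\<close> makes the left side nonpositive.
  Together with the same bound for \<open>- f\<close>, this excludes a Jordan block above
  \<open>h\<close>.\<close>

lemma ruelle_operator_coboundary_le:
  assumes "continuous_on UNIV f" "\<And>y. ruelle_operator stl B f y - l * f y = c * h y"
  shows "c \<le> 0"
proof -
  obtain x where "\<And>y. f y / h y \<le> f x / h x"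
    using quotient_attains_max[OF assms(1)] by blast
  then have "c * h x \<le> 0"
    using ruelle_operator_le_at_max assms(2) by metis
  with h_pos[of x] show ?thesis
    by (simp add: mult_le_0_iff)
qed

lemma ruelle_operator_coboundary_eq_0:
  assumes f: "continuous_on UNIV f" and c: "\<And>y. ruelle_operator stl B f y - l * f y = c * h y"
  shows "c = 0"
proof (rule antisym)
  show "c \<le> 0"
    using assms by (rule ruelle_operator_coboundary_le)
  have "ruelle_operator stl B (\<lambda>x. - f x) y - l * - f y = - c * h y" for y
    using c[of y] by (simp add: ruelle_operator_shift sum_negf)
  then have "- c \<le> 0"
    using f by (intro ruelle_operator_coboundary_le[of "\<lambda>x. - f x"] continuous_intros)
  then show "0 \<le> c" by simp
qed

lemma eigenspace_one_dimensional:
  assumes f: "continuous_on UNIV f" and eigen: "\<And>y. ruelle_operator stl B f y - l * f y = 0"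
  shows "\<exists>c. \<forall>x. f x = c * h x"
proof -
  define g where "g = (\<lambda>x. f x / h x)"
  obtain x0 where x0: "\<And>y. g y \<le> g x0"
    using quotient_attains_max[OF f] unfolding g_def by blast
  have step: "g (i ## x) = g x0" if "g x = g x0" for i x
  proof -
    \<comment> \<open>At a maximum of \<open>g\<close> all summands are nonnegative, so a zero sum
      makes each vanish; as the weights are positive, \<open>g\<close> is maximal at every preimage
      too.\<close>
    have "(\<Sum>i\<in>UNIV. exp (B (i ## x)) * h (i ## x) * (g x - g (i ## x))) = 0"
      using eigen[of x] ruelle_operator_diff[of f x]
      by (simp add: g_def right_diff_distrib sum_subtractf)
    then have "\<forall>i\<in>UNIV. exp (B (i ## x)) * h (i ## x) * (g x - g (i ## x)) = 0"
      using x0 h_pos that by (subst (asm) sum_nonneg_eq_0_iff) (auto simp: less_imp_le)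
    then have "exp (B (i ## x)) * h (i ## x) * (g x - g (i ## x)) = 0"
      by blast
    then show ?thesis
      using h_pos[of "i ## x"] that by simp
  qed
  have orbit: "g (w @- x0) = g x0" for w
    by (induction w) (auto intro: step)
  \<comment> \<open>Putting the first letters of any target \<open>z\<close> in front of
    \<open>x0\<close> gives iterated preimages of \<open>x0\<close> that converge to
    \<open>z\<close>.\<close>
  have dense: "(\<lambda>n. stake n z @- x0) \<longlonglongrightarrow> z" for z
  proof (rule metric_LIMSEQ_I)
    fix r :: real
    assume "0 < r"
    then obtain N where N: "(1 / 2 :: real) ^ N < r"
      using real_arch_pow_inv[of r "1/2"] by auto
    have "dist (stake n z @- x0) z < r" if "n \<ge> N" for n
    proof -
      have "dist (stake n z @- x0) z \<le> (1 / 2) ^ Suc n"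
        by (rule dist_stream_le) (simp add: stake_shift)
      also have "\<dots> \<le> (1 / 2) ^ N"
        using that by (intro power_decreasing) auto
      finally show ?thesis using N by simp
    qed
    then show "\<exists>N. \<forall>n\<ge>N. dist (stake n z @- x0) z < r" by blast
  qed
  have cont_g: "continuous_on UNIV g"
    unfolding g_def using f cont_h h_pos
    by (intro continuous_intros) (auto simp: less_imp_neq[THEN not_sym])
  have "g z = g x0" for z
  proof -
    have "(\<lambda>n. g (stake n z @- x0)) \<longlonglongrightarrow> g z"
      by (rule continuous_on_tendsto_compose[OF cont_g dense]) auto
    then show ?thesis
      by (simp add: orbit LIMSEQ_const_iff)
  qed
  then have "f x = g x0 * h x" for x
  proof -
    have "f x = g x * h x"
      using h_pos[of x] by (simp add: g_def)
    with \<open>g x = g x0\<close> show ?thesis by simp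
  qed
  then show ?thesis by blast
qed

text \<open>With one factor peeled off, the induction hypothesis makes the image of \<open>f\<close>
  a multiple \<open>c * h\<close>. Such an image is possible only for \<open>c = 0\<close>, so
  \<open>f\<close> is a true eigenfunction.\<close>

lemma generalized_eigenspace_one_dimensional:
  assumes "continuous_on UNIV f"
    and "((\<lambda>g y. ruelle_operator stl B g y - l * g y) ^^ n) f = (\<lambda>_. 0)"
  shows "\<exists>c. \<forall>x. f x = c * h x"
  using assms
proof (induction n arbitrary: f)
  case 0
  then show ?case by (auto intro: exI[of _ 0])
next
  case (Suc n)
  let ?D = "\<lambda>g y. ruelle_operator stl B g y - l * g y"
  have "continuous_on UNIV (?D f)"
    using Suc.prems(1) cont_B
    by (intro continuous_intros continuous_on_ruelle_operator_shift)
  moreover have "(?D ^^ n) (?D f) = (\<lambda>_. 0)"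
    using Suc.prems(2) by (simp only: funpow_Suc_right o_apply)
  ultimately obtain c where c: "\<And>y. ?D f y = c * h y"
    using Suc.IH by blast
  moreover have "c = 0"
    using Suc.prems(1) c by (rule ruelle_operator_coboundary_eq_0)
  ultimately show ?case
    using Suc.prems(1) by (intro eigenspace_one_dimensional) auto
qed

text \<open>The triangle inequality bounds \<open>\<bar>m\<bar> * \<bar>f\<bar>\<close> by the
  operator applied to \<open>\<bar>f\<bar>\<close>; at a maximum of \<open>\<bar>f\<bar> / h\<close>
  the latter is at most \<open>l * \<bar>f\<bar>\<close>.\<close>

lemma eigenvalue_le:
  assumes f: "continuous_on UNIV f" "f z \<noteq> 0" and eigen: "\<And>y. ruelle_operator stl B f y = m * f y"
  shows "\<bar>m\<bar> \<le> l"
proof -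
  obtain x where x: "\<And>y. \<bar>f y\<bar> / h y \<le> \<bar>f x\<bar> / h x"
    using quotient_attains_max[of "\<lambda>x. \<bar>f x\<bar>"] f(1) continuous_on_rabs by blast
  have "0 < \<bar>f z\<bar> / h z"
    using f(2) h_pos by simp
  also note x[of z]
  finally have pos: "0 < \<bar>f x\<bar>"
    by auto
  have "\<bar>m\<bar> * \<bar>f x\<bar> = \<bar>ruelle_operator stl B f x\<bar>"
    by (simp add: eigen abs_mult)
  also have "\<dots> \<le> ruelle_operator stl B (\<lambda>x. \<bar>f x\<bar>) x"
    unfolding ruelle_operator_shift
    by (rule order_trans[OF sum_abs]) (simp add: abs_mult)
  also have "\<dots> \<le> l * \<bar>f x\<bar>"
    using ruelle_operator_le_at_max[of "\<lambda>x. \<bar>f x\<bar>", OF x] by simp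
  finally show ?thesis
    using pos by simp
qed

end

text \<open>An explicit positive eigenfunction certifies its own eigenvalue as the main one:
  simplicity and maximality come from the maximum principle above.\<close>

lemma main_eigenfunction_shiftI:
  fixes B h :: "'a::finite stream \<Rightarrow> real"
  assumes B: "lipschitz B" and h: "positive_eigenfunction stl B l h" and l: "0 < l"
  shows "main_eigenfunction stl B h"
proof -
  have *: "continuous_on UNIV B" "continuous_on UNIV h" "\<And>x. 0 < h x"
    "\<And>y. ruelle_operator stl B h y = l * h y"
    using B h by (auto simp: positive_eigenfunction_def intro: lipschitz_continuous_on)
  have "main_eigenvalue stl B l"
    unfolding main_eigenvalue_def
    using l h generalized_eigenspace_one_dimensional[OF *] eigenvalue_le[OF *] by blast
  with h show ?thesis
    unfolding main_eigenfunction_def by blast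
qed

section \<open>Inverse branches of the cellular automaton\<close>

lemma cellular_automaton_simps [simp]:
  "shd (cellular_automaton \<phi> y) = \<phi> (shd y) (shd (stl y))"
  "stl (cellular_automaton \<phi> y) = cellular_automaton \<phi> (stl y)"
  by (simp_all add: cellular_automaton_def)

text \<open>A productive form of the inverse branch, open to coinduction: after the letter
  \<open>j\<close>, a bijective \<open>\<phi> j\<close> leaves exactly one next letter
  \<open>b\<close> with \<open>\<phi> j b = shd x\<close>.\<close>

primcorec branch :: "('a \<Rightarrow> 'a \<Rightarrow> 'a) \<Rightarrow> 'a \<Rightarrow> 'a stream \<Rightarrow> 'a stream" where
  "branch \<phi> j x = j ## branch \<phi> (inv (\<phi> j) (shd x)) (stl x)"

context
  fixes \<phi> :: "'a::finite \<Rightarrow> 'a \<Rightarrow> 'a"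
  assumes bij: "\<forall>a. bij (\<phi> a)"
begin

lemma cellular_automaton_branch: "cellular_automaton \<phi> (branch \<phi> j x) = x"
proof (coinduction arbitrary: j x)
  case Eq_stream
  have "\<phi> j (inv (\<phi> j) (shd x)) = shd x"
    using bij by (simp add: bij_is_surj surj_f_inv_f)
  then show ?case
    by (metis branch.sel cellular_automaton_simps)
qed

lemma branch_cellular_automaton: "branch \<phi> (shd y) (cellular_automaton \<phi> y) = y"
proof (coinduction arbitrary: y)
  case Eq_stream
  have "inv (\<phi> (shd y)) (\<phi> (shd y) (shd (stl y))) = shd (stl y)"
    using bij by (simp add: bij_is_inj inv_f_f)
  then show ?case
    by (metis branch.sel cellular_automaton_simps)
qed

text \<open>The two preceding cancellation laws give existence and uniqueness for the definite
  description.\<close>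

lemma inverse_branch_eq: "inverse_branch \<phi> j x = branch \<phi> j x"
  unfolding inverse_branch_def
proof (rule the_equality)
  show "cellular_automaton \<phi> (branch \<phi> j x) = x \<and> shd (branch \<phi> j x) = j"
    by (simp add: cellular_automaton_branch)
  show "y = branch \<phi> j x" if "cellular_automaton \<phi> y = x \<and> shd y = j" for y
    using branch_cellular_automaton[of y] that by simp
qed

lemma inverse_branch_cellular_automaton: "inverse_branch \<phi> (shd y) (cellular_automaton \<phi> y) = y"
  by (simp add: inverse_branch_eq branch_cellular_automaton)

text \<open>The first letter is always \<open>j\<close> and each letter of \<open>x\<close>
  determines one more, so \<open>n\<close> letters of \<open>x\<close> fix \<open>n + 1\<close>
  letters of the branch.\<close>

lemma dist_inverse_branch_le: "dist (inverse_branch \<phi> j x) (inverse_branch \<phi> j y) \<le> dist x y / 2"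
proof -
  have "stake (Suc n) (branch \<phi> j x) = stake (Suc n) (branch \<phi> j y)" if "stake n x = stake n y" for n
    using that
  proof (induction n arbitrary: j x y)
    case (Suc n)
    then have "shd x = shd y" "stake n (stl x) = stake n (stl y)"
      by simp_all
    with Suc.IH[of "stl x" "stl y" "inv (\<phi> j) (shd y)"] show ?case
      by simp
  qed simp
  then show ?thesis
    unfolding inverse_branch_eq by (rule dist_stream_half)
qed

text \<open>Each preimage is the branch indexed by its own first letter, so the sum over preimages
  is a sum over letters.\<close>

lemma ruelle_operator_cellular_automaton:
  "ruelle_operator (cellular_automaton \<phi>) B f y =
     (\<Sum>i\<in>UNIV. exp (B (inverse_branch \<phi> i y)) * f (inverse_branch \<phi> i y))"
proof -
  have "{x. cellular_automaton \<phi> x = y} = range (\<lambda>i. inverse_branch \<phi> i y)"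
    using inverse_branch_cellular_automaton
    by (auto simp: inverse_branch_eq cellular_automaton_branch) (metis rangeI)
  moreover have "inj (\<lambda>i. inverse_branch \<phi> i y)"
    unfolding inverse_branch_eq by (metis branch.sel(1) injI)
  ultimately show ?thesis
    by (simp add: ruelle_operator_def sum.reindex)
qed

section \<open>The eigenfunction given by an involution kernel\<close>

text \<open>
  Every past is of the form \<open>inverse_branch \<phi> i y\<close>, so the identity can be iterated on differences of
  \<open>W\<close> in the first variable; the futures get closer at each step.
\<close>

lemma involution_kernel_lipschitz_future:
  assumes kernel: "involution_kernel \<phi> A A' W"
    and C: "0 \<le> C" "\<And>x y. \<bar>A x - A y\<bar> \<le> C * dist x y"
  shows "W (x, z) - W (x', z) \<le> C * dist x x'"
proof (rule field_le_epsilon)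
  fix e :: real
  assume "0 < e"
  have "uniformly_continuous_on UNIV W"
    using kernel compact_Times[OF compact_UNIV_stream compact_UNIV_stream]
    by (intro compact_uniformly_continuous) (auto simp: involution_kernel_def)
  then obtain d where d: "0 < d" "\<And>p q. dist p q < d \<Longrightarrow> dist (W p) (W q) < e"
    using \<open>0 < e\<close> unfolding uniformly_continuous_on_def by (metis UNIV_I)
  \<comment> \<open>Uniform continuity handles distances below \<open>d\<close>. Each induction step
    doubles the admissible distance, since prepending a letter halves it; the error \<open>e\<close>
    is paid only once, in the base case.\<close>
  have *: "W (x, z) - W (x', z) \<le> C * dist x x' + e" if "dist x x' < d * 2 ^ n" for n x x' z
    using that
  proof (induction n arbitrary: x x' z)
    case 0
    then have "dist (W (x, z)) (W (x', z)) < e"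
      by (intro d(2)) (simp add: dist_Pair_Pair)
    moreover have "0 \<le> C * dist x x'"
      using C(1) by simp
    ultimately show ?case
      unfolding dist_real_def by linarith
  next
    case (Suc n)
    define i y where "i = shd z" and "y = cellular_automaton \<phi> z"
    have z: "z = inverse_branch \<phi> i y"
      by (simp add: i_def y_def inverse_branch_cellular_automaton)
    have half: "dist (i ## x) (i ## x') \<le> dist x x' / 2"
      by (rule dist_SCons_le)
    \<comment> \<open>Both points have the same past, so the term \<open>A' z\<close> cancels. Apart
      from \<open>e\<close>, each of the two remaining differences costs at most half of
      \<open>C * dist x x'\<close>.\<close>
    have "W (x, z) - W (x', z) = (A (i ## x) - A (i ## x')) + (W (i ## x, y) - W (i ## x', y))"
      using kernel unfolding involution_kernel_def z by (metis add_diff_add add_diff_cancel_left)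
    also have "W (i ## x, y) - W (i ## x', y) \<le> C * dist (i ## x) (i ## x') + e"
      using half Suc.prems by (intro Suc.IH) simp
    also have "A (i ## x) - A (i ## x') \<le> C * dist (i ## x) (i ## x')"
      using C(2)[of "i ## x" "i ## x'"] by simp
    finally show ?case
      using mult_left_mono[OF half C(1)] by simp
  qed
  \<comment> \<open>The space has diameter at most 1, so a scale above 1 covers every pair of
    futures.\<close>
  obtain n where "1 / d < 2 ^ n"
    using real_arch_pow[of 2 "1 / d"] by auto
  then have "1 < d * 2 ^ n"
    using d(1) by (simp add: field_simps)
  then show "W (x, z) - W (x', z) \<le> C * dist x x' + e"
    using dist_stream_le_1[of x x'] by (intro *[of _ _ n]) simp
qed

end

section \<open>Integrability and logarithmic Lipschitz bounds\<close>

lemma integrable_continuous_stream: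
  fixes f :: "'a::finite stream \<Rightarrow> real"
  assumes "finite_measure M" "sets M = sets borel" "continuous_on UNIV f"
  shows "integrable M f"
proof -
  interpret finite_measure M by fact
  have "bounded (range f)"
    using assms(3) compact_UNIV_stream by (intro compact_imp_bounded compact_continuous_image)
  then obtain K where "\<And>x. norm (f x) \<le> K"
    by (auto simp: bounded_iff)
  moreover have "f \<in> borel_measurable M"
    using borel_measurable_continuous_onI[OF assms(3)] assms(2) measurable_cong_sets by blast
  ultimately show ?thesis
    by (intro integrable_const_bound) auto
qed

text \<open>This is \<open>1 - t \<le> exp (- t)\<close> multiplied by \<open>exp t\<close>.\<close>

lemma exp_minus_one_le: "exp t - 1 \<le> t * exp t" for t :: real
  using exp_ge_add_one_self[of "- t"] mult_right_mono[of "1 - t" "exp (- t)" "exp t"]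
  by (simp add: algebra_simps flip: exp_add)

text \<open>The hypothesis says that \<open>ln h\<close> is \<open>C\<close>-Lipschitz. On a space
  of diameter at most 1 this bounds \<open>h\<close>, and exponentiation is Lipschitz on a bounded
  range.\<close>

lemma lipschitz_if_log_lipschitz:
  fixes h :: "'a stream \<Rightarrow> real"
  assumes pos: "\<And>x. 0 < h x" and C: "0 \<le> C" and le: "\<And>x y. h x \<le> exp (C * dist x y) * h y"
  shows "lipschitz h"
proof -
  \<comment> \<open>\<open>undefined\<close> is an arbitrary base point:
    \<open>exp C * h undefined\<close> bounds \<open>h\<close>, while \<open>C * exp C\<close>
    bounds the slope of \<open>exp (C * t)\<close> for \<open>t \<le> 1\<close>.\<close>
  define K where "K = C * exp C * (exp C * h undefined)"
  have K0: "0 \<le> K"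
    using C pos[of undefined] by (simp add: K_def)
  have exp_le: "exp (C * dist x y) \<le> exp C" for x y :: "'a stream"
    using dist_stream_le_1[of x y] C by (simp add: mult_left_le)
  have bound: "h y \<le> exp C * h undefined" for y
    using le[of y undefined] mult_right_mono[OF exp_le[of y undefined], of "h undefined"]
      pos[of undefined] by linarith
  have one_sided: "h x - h y \<le> K * dist x y" for x y
  proof -
    let ?t = "C * dist x y"
    have "h x - h y \<le> (exp ?t - 1) * h y"
      using le[of x y] by (simp add: algebra_simps)
    also have "\<dots> \<le> (?t * exp C) * (exp C * h undefined)"
    proof (rule mult_mono)
      show "exp ?t - 1 \<le> ?t * exp C"
        using exp_minus_one_le[of ?t] mult_left_mono[OF exp_le[of x y], of ?t] C by simp
    qed (use bound pos C in \<open>auto simp: less_imp_le\<close>)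
    finally show ?thesis by (simp add: K_def mult_ac)
  qed
  have "\<bar>h x - h y\<bar> \<le> K * dist x y" for x y
    using one_sided[of x y] one_sided[of y x] by (simp add: abs_le_iff dist_commute)
  then show ?thesis
    using K0 by (rule lipschitzI)
qed

lemma positive_eigenfunction_integral_kernel:
  fixes \<phi> :: "'a::finite \<Rightarrow> 'a \<Rightarrow> 'a"
  assumes bij: "\<forall>a. bij (\<phi> a)" and A: "lipschitz A"
    and kernel: "involution_kernel \<phi> A A' W"
    and M: "finite_measure \<rho>" "sets \<rho> = sets borel" "emeasure \<rho> (space \<rho>) \<noteq> 0"
    and dual: "\<And>f. continuous_on UNIV f \<Longrightarrow>
      (\<integral>y. ruelle_operator (cellular_automaton \<phi>) A' f y \<partial>\<rho>) = l * (\<integral>y. f y \<partial>\<rho>)"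
  shows "positive_eigenfunction stl A l (\<lambda>x. \<integral>y. exp (W (x, y)) \<partial>\<rho>)"
proof -
  interpret finite_measure \<rho> by fact
  define h where "h = (\<lambda>x. \<integral>y. exp (W (x, y)) \<partial>\<rho>)"
  have contW: "continuous_on UNIV W"
    using kernel by (simp add: involution_kernel_def)
  have cont: "continuous_on UNIV (\<lambda>y. W (x, y))" for x
    by (rule continuous_on_compose2[OF contW]) (auto intro!: continuous_intros)
  have cont_exp: "continuous_on UNIV (\<lambda>y. exp (W (x, y)))" for x
    using cont by (intro continuous_intros)
  note int = integrable_continuous_stream[OF M(1,2)]
  obtain C where C: "0 \<le> C" "\<And>x y. \<bar>A x - A y\<bar> \<le> C * dist x y"
    using A by (rule lipschitzE) blast
  have pos: "0 < h x" for x
  proof -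
    \<comment> \<open>A minimum of \<open>W\<close> over the compact space of pasts bounds the
      integrand below by a positive constant, and \<open>\<rho>\<close> has positive mass.\<close>
    have "\<exists>z\<in>UNIV. \<forall>y\<in>UNIV. W (x, z) \<le> W (x, y)"
      using compact_UNIV_stream cont by (intro continuous_attains_inf) auto
    then obtain z where z: "\<And>y. W (x, z) \<le> W (x, y)"
      by auto
    have "0 < (\<integral>y. exp (W (x, z)) \<partial>\<rho>)"
      using M(3) by (simp add: emeasure_eq_measure zero_less_measure_iff)
    also have "\<dots> \<le> h x"
      unfolding h_def using z int[OF cont_exp] by (intro integral_mono) auto
    finally show ?thesis .
  qed
  \<comment> \<open>The Lipschitz bound for \<open>W\<close> in the future is uniform in the past;
    exponentiated, it is a multiplicative bound that survives integration.\<close>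
  have "h x \<le> exp (C * dist x x') * h x'" for x x'
  proof -
    have "h x \<le> (\<integral>y. exp (C * dist x x') * exp (W (x', y)) \<partial>\<rho>)"
      unfolding h_def
    proof (rule integral_mono)
      fix y
      show "exp (W (x, y)) \<le> exp (C * dist x x') * exp (W (x', y))"
        using involution_kernel_lipschitz_future[OF bij kernel C, of x y x']
        by (simp flip: exp_add)
    qed (use int[OF cont_exp] in auto)
    then show ?thesis by (simp add: h_def)
  qed
  then have "lipschitz h"
    using pos C(1) by (intro lipschitz_if_log_lipschitz[of h C])
  moreover have "ruelle_operator stl A h x = l * h x" for x
  proof -
    have "ruelle_operator stl A h x =
        (\<Sum>i\<in>UNIV. \<integral>y. exp (A (i ## x)) * exp (W (i ## x, y)) \<partial>\<rho>)"
      by (simp add: ruelle_operator_shift h_def)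
    also have "\<dots> = (\<integral>y. (\<Sum>i\<in>UNIV. exp (A (i ## x)) * exp (W (i ## x, y))) \<partial>\<rho>)"
      using int[OF cont_exp] by (intro Bochner_Integration.integral_sum[symmetric]) auto
    also have "\<dots> = (\<integral>y. ruelle_operator (cellular_automaton \<phi>) A' (\<lambda>y. exp (W (x, y))) y \<partial>\<rho>)"
      using kernel
      by (simp add: ruelle_operator_cellular_automaton[OF bij] involution_kernel_def flip: exp_add)
    also have "\<dots> = l * h x"
      using dual[OF cont_exp] by (simp add: h_def)
    finally show ?thesis .
  qed
  ultimately show ?thesis
    using pos unfolding positive_eigenfunction_def h_def by blast
qed

section \<open>Existence of the involution kernel\<close>

text \<open>The backward orbit of \<open>y\<close> whose branches are chosen by the letters of
  \<open>x\<close>, the first letter acting first. Recursion on \<open>stl x\<close> makes one orbit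
  step a change of starting point, as in the kernel identity.\<close>

primrec past_orbit :: "('a \<Rightarrow> 'a \<Rightarrow> 'a) \<Rightarrow> nat \<Rightarrow> 'a stream \<Rightarrow> 'a stream \<Rightarrow> 'a stream" where
  "past_orbit \<phi> 0 x y = y"
| "past_orbit \<phi> (Suc n) x y = past_orbit \<phi> n (stl x) (inverse_branch \<phi> (shd x) y)"

lemma dist_past_orbit_le:
  fixes \<phi> :: "'a::finite \<Rightarrow> 'a \<Rightarrow> 'a"
  assumes "\<forall>a. bij (\<phi> a)"
  shows "dist (past_orbit \<phi> n x y) (past_orbit \<phi> n x y') \<le> dist y y' * (1 / 2) ^ n"
proof (induction n arbitrary: x y y')
  case (Suc n)
  have "dist (past_orbit \<phi> (Suc n) x y) (past_orbit \<phi> (Suc n) x y')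
      \<le> dist (inverse_branch \<phi> (shd x) y) (inverse_branch \<phi> (shd x) y') * (1 / 2) ^ n"
    using Suc.IH by simp
  also have "\<dots> \<le> (dist y y' / 2) * (1 / 2) ^ n"
    by (intro mult_right_mono dist_inverse_branch_le[OF assms]) simp
  finally show ?case by simp
qed simp

lemma geometric_half_bound:
  fixes a :: "nat \<Rightarrow> real"
  assumes "\<And>k. \<bar>a k\<bar> \<le> K * (1 / 2) ^ k"
  shows "summable a" "\<bar>suminf a\<bar> \<le> 2 * K"
proof -
  have sums: "(\<lambda>k. K * (1 / 2) ^ k) sums (K * 2)"
    using sums_mult[OF geometric_sums[of "1/2::real"]] by simp
  show sa: "summable a"
    by (rule summable_comparison_test'[OF sums_summable[OF sums]]) (use assms in auto)
  have "suminf a \<le> K * 2"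
    using assms by (intro sums_le[OF _ summable_sums[OF sa] sums]) (simp add: abs_le_iff)
  moreover have "- suminf a \<le> K * 2"
    using assms by (intro sums_le[OF _ sums_minus[OF summable_sums[OF sa]] sums]) (simp add: abs_le_iff)
  ultimately show "\<bar>suminf a\<bar> \<le> 2 * K" by simp
qed

text \<open>
  The kernel compares the Birkhoff sums of \<open>A'\<close> along the backward orbits of \<open>y\<close> and of a fixed base
  point that use the same inverse branches, namely those prescribed by \<open>x\<close>.
\<close>

lemma involution_kernel_exists:
  fixes \<phi> :: "'a::finite \<Rightarrow> 'a \<Rightarrow> 'a"
  assumes bij: "\<forall>a. bij (\<phi> a)" and A': "lipschitz A'"
  shows "\<exists>A W. lipschitz A \<and> involution_kernel \<phi> A A' W"
proof -
  obtain C where C: "0 \<le> C" "\<And>x y. \<bar>A' x - A' y\<bar> \<le> C * dist x y"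
    using A' by (rule lipschitzE) blast
  define y0 :: "'a stream" where "y0 = undefined"
  let ?\<tau> = "inverse_branch \<phi>"
  \<comment> \<open>Two free pasts make \<open>V\<close> additive, so the base point can be moved.
    The sum starts at \<open>Suc n\<close> because the kernel identity evaluates \<open>A'\<close>
    only after a branch has been applied.\<close>
  define V where "V = (\<lambda>y y' x.
    \<Sum>n. A' (past_orbit \<phi> (Suc n) x y) - A' (past_orbit \<phi> (Suc n) x y'))"
  define W where "W = (\<lambda>(x, y). V y y0 x)"
  \<comment> \<open>Forced by the kernel identity at the past \<open>y0\<close>, where
    \<open>W\<close> vanishes.\<close>
  define A where "A = (\<lambda>x. A' (?\<tau> (shd x) y0) + V (?\<tau> (shd x) y0) y0 (stl x))"
  have term_le: "\<bar>A' (past_orbit \<phi> (Suc n) x y) - A' (past_orbit \<phi> (Suc n) x y')\<bar>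
      \<le> C / 2 * dist y y' * (1 / 2) ^ n" for n x y y'
    using C(2)[of "past_orbit \<phi> (Suc n) x y" "past_orbit \<phi> (Suc n) x y'"]
      mult_left_mono[OF dist_past_orbit_le[OF bij, of "Suc n" x y y'] C(1)]
    by (simp del: past_orbit.simps)
  have summable_term:
    "summable (\<lambda>n. A' (past_orbit \<phi> (Suc n) x y) - A' (past_orbit \<phi> (Suc n) x y'))" for x y y'
    using term_le by (rule geometric_half_bound(1))
  have V_le: "\<bar>V y y' x\<bar> \<le> C * dist y y'" for y y' x
  proof -
    have "\<bar>V y y' x\<bar> \<le> 2 * (C / 2 * dist y y')"
      unfolding V_def using term_le by (rule geometric_half_bound(2))
    then show ?thesis by simp
  qed
  have V_add: "V y y' x + V y' y'' x = V y y'' x" for y y' y'' x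
    unfolding V_def by (subst suminf_add[OF summable_term summable_term]) simp
  have V_unfold: "V y y' x =
      A' (?\<tau> (shd x) y) - A' (?\<tau> (shd x) y') + V (?\<tau> (shd x) y) (?\<tau> (shd x) y') (stl x)" for y y' x
    using suminf_split_head[OF summable_term[of x y y']] by (simp add: V_def)
  \<comment> \<open>Common leading letters select the same branches, so the initial terms cancel;
    the remaining sums start from pasts whose distance has shrunk by the factor
    \<open>(1 / 2) ^ n\<close>.\<close>
  have V_future: "\<bar>V y y' x - V y y' x'\<bar> \<le> 2 * C * dist y y' * (1 / 2) ^ n"
    if "stake n x = stake n x'" for n x x' y y'
    using that
  proof (induction n arbitrary: x x' y y')
    case 0
    then show ?case
      using V_le[of y y' x] V_le[of y y' x'] by simp
  next
    case (Suc n)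
    then have eq: "shd x = shd x'" "stake n (stl x) = stake n (stl x')"
      by simp_all
    let ?i = "shd x'"
    have "\<bar>V y y' x - V y y' x'\<bar> = \<bar>V (?\<tau> ?i y) (?\<tau> ?i y') (stl x) - V (?\<tau> ?i y) (?\<tau> ?i y') (stl x')\<bar>"
      using V_unfold[of y y' x] V_unfold[of y y' x'] eq(1) by simp
    also have "\<dots> \<le> 2 * C * dist (?\<tau> ?i y) (?\<tau> ?i y') * (1 / 2) ^ n"
      using eq(2) by (rule Suc.IH)
    also have "\<dots> \<le> 2 * C * (dist y y' / 2) * (1 / 2) ^ n"
      using C(1) by (intro mult_right_mono mult_left_mono dist_inverse_branch_le[OF bij]) auto
    finally show ?case by simp
  qed
  have V_le_C: "\<bar>V y y' x\<bar> \<le> C" for y y' x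
    using V_le[of y y' x] mult_left_mono[OF dist_stream_le_1[of y y'] C(1)] by simp
  have V_future': "\<bar>V y y' x - V y y' x'\<bar> \<le> 2 * C * (1 / 2) ^ n"
    if "stake n x = stake n x'" for n x x' y y'
  proof -
    have "2 * C * dist y y' * (1 / 2) ^ n \<le> 2 * C * 1 * (1 / 2) ^ n"
      using C(1) by (intro mult_right_mono mult_left_mono dist_stream_le_1) auto
    with V_future[OF that, of y y'] show ?thesis by simp
  qed
  have "lipschitz W"
  proof (rule lipschitzI)
    fix p q :: "'a stream \<times> 'a stream"
    obtain x y x' y' where pq: "p = (x, y)" "q = (x', y')"
      by fastforce
    have "\<bar>V y' y0 x - V y' y0 x'\<bar> \<le> 2 * (2 * C) * dist x x'"
      using V_future' by (rule dist_boundI_stake)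
    also have "\<dots> \<le> 4 * C * dist p q"
      using C(1) dist_fst_le[of p q] by (simp add: pq mult_left_mono)
    finally have "\<bar>V y' y0 x - V y' y0 x'\<bar> \<le> 4 * C * dist p q" .
    moreover have "\<bar>V y y' x\<bar> \<le> C * dist p q"
      using V_le[of y y' x] mult_left_mono[OF dist_snd_le[of p q] C(1)] by (simp add: pq)
    \<comment> \<open>The past is changed first at the fixed future \<open>x\<close>, then the
      future at the fixed past \<open>y'\<close>; the costs \<open>C\<close> and
      \<open>4 * C\<close> add up to \<open>5 * C\<close>.\<close>
    moreover have "W p - W q = V y y' x + (V y' y0 x - V y' y0 x')"
      using V_add[of y y' x y0] by (simp add: W_def pq)
    ultimately show "\<bar>W p - W q\<bar> \<le> (5 * C) * dist p q"
      by linarith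
  qed (use C(1) in simp)
  then have "continuous_on UNIV W"
    by (rule lipschitz_continuous_on)
  moreover have "A (i ## x) + W (i ## x, y) = A' (?\<tau> i y) + W (x, ?\<tau> i y)" for i x y
    using V_unfold[of y y0 "i ## x"] V_add[of "?\<tau> i y" "?\<tau> i y0" x y0]
    by (simp add: A_def W_def)
  ultimately have "involution_kernel \<phi> A A' W"
    by (simp add: involution_kernel_def)
  moreover have "lipschitz A"
  proof (rule lipschitzI)
    \<comment> \<open>For \<open>n = 0\<close> the three differences cost at most
      \<open>3 * C\<close>. Otherwise the tails share one letter fewer, and \<open>2 * C\<close> at
      exponent \<open>m\<close> is \<open>4 * C\<close> at \<open>Suc m\<close>.\<close>
    have "\<bar>A x - A x'\<bar> \<le> 4 * C * (1 / 2) ^ n" if eq: "stake n x = stake n x'" for n x x'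
    proof (cases n)
      case 0
      have "\<bar>A' (?\<tau> (shd x) y0) - A' (?\<tau> (shd x') y0)\<bar> \<le> C"
        using C(2)[of "?\<tau> (shd x) y0" "?\<tau> (shd x') y0"]
          mult_left_mono[OF dist_stream_le_1[of "?\<tau> (shd x) y0" "?\<tau> (shd x') y0"] C(1)] by simp
      then show ?thesis
        using V_le_C[of "?\<tau> (shd x) y0" y0 "stl x"] V_le_C[of "?\<tau> (shd x') y0" y0 "stl x'"] C(1)
        unfolding A_def 0 by simp
    next
      case (Suc m)
      with eq have "shd x = shd x'" "stake m (stl x) = stake m (stl x')"
        by simp_all
      with V_future'[of m "stl x" "stl x'" "?\<tau> (shd x') y0" y0] show ?thesis
        by (simp add: A_def Suc)
    qed
    then show "\<bar>A x - A x'\<bar> \<le> 2 * (4 * C) * dist x x'" for x x'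
      by (rule dist_boundI_stake)
  qed (use C(1) in simp)
  ultimately show ?thesis by blast
qed

theorem proposition4p1:
  fixes \<phi> :: "'a::finite \<Rightarrow> 'a \<Rightarrow> 'a"
  assumes permutative: "\<forall>a. bij (\<phi> a)"
  shows "(\<forall>(A :: 'a stream \<Rightarrow> real) A' W \<rho>.
            lipschitz A \<and> lipschitz A' \<and> involution_kernel \<phi> A A' W \<and>
            eigenprobability (cellular_automaton \<phi>) A' \<rho> \<longrightarrow>
            main_eigenfunction stl A (\<lambda>x. \<integral>y. exp (W (x, y)) \<partial>\<rho>)) \<and>
         (\<forall>A' :: 'a stream \<Rightarrow> real. lipschitz A' \<longrightarrow>
            (\<exists>A W. lipschitz A \<and> involution_kernel \<phi> A A' W))"
proof (intro conjI allI impI, elim conjE)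
  fix A A' :: "'a stream \<Rightarrow> real" and W \<rho>
  assume *: "lipschitz A" "lipschitz A'" "involution_kernel \<phi> A A' W"
    and \<rho>: "eigenprobability (cellular_automaton \<phi>) A' \<rho>"
  from \<rho> obtain l where l: "main_eigenvalue (cellular_automaton \<phi>) A' l"
    and dual: "\<And>f. continuous_on UNIV f \<Longrightarrow>
      (\<integral>y. ruelle_operator (cellular_automaton \<phi>) A' f y \<partial>\<rho>) = l * (\<integral>y. f y \<partial>\<rho>)"
    unfolding eigenprobability_def by blast
  have "finite_measure \<rho>" "sets \<rho> = sets borel" "emeasure \<rho> (space \<rho>) \<noteq> 0"
    using \<rho> by (auto simp: eigenprobability_def intro: finite_measureI)
  then have "positive_eigenfunction stl A l (\<lambda>x. \<integral>y. exp (W (x, y)) \<partial>\<rho>)"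
    using positive_eigenfunction_integral_kernel[OF permutative *(1,3)] dual by blast
  \<comment> \<open>The same \<open>l\<close> serves both operators; its positivity comes from being
    the main eigenvalue for the automaton.\<close>
  then show "main_eigenfunction stl A (\<lambda>x. \<integral>y. exp (W (x, y)) \<partial>\<rho>)"
    using *(1) l by (intro main_eigenfunction_shiftI) (auto simp: main_eigenvalue_def)
qed (rule involution_kernel_exists[OF permutative])

end
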